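(* Let $\mathscr{H}$ be a complex Hilbert space and let $A\in\mathbb{B}(\mathscr{H})$. Then $$w^4(A)\leq\frac{1}{4}\left[w^2(A^2)+\frac{1}{4}\left\|(A^*A)^2+(AA^* )^2\right\|+\frac{1}{2}w(A^*A^2A^* )+w(A^2)\,\|A^*A+AA^*\|\right].$$
   Context: $\mathbb{B}(\mathscr{H})$ is the algebra of all bounded linear operators on the complex Hilbert space $\mathscr{H}$, and $\|\cdot\|$ is the operator norm. For $T\in\mathbb{B}(\mathscr{H})$, the numerical radius is $w(T)=\sup\{|\langle Tx,x\rangle|: x\in\mathscr{H},\ \|x\|=1\}$, and $w^k(T)$ means $(w(T))^k$. *)

theory Defs
  imports "HOL-Analysis.Analysis"
begin

class complex_vector = real_vector +
  fixes scaleC :: "complex \<Rightarrow> 'a \<Rightarrow> 'a"  (infixr \<open>*\<^sub>C\<close> 75)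
  assumes scaleC_add_right: "a *\<^sub>C (x + y) = a *\<^sub>C x + a *\<^sub>C y"
    and scaleC_add_left: "(a + b) *\<^sub>C x = a *\<^sub>C x + b *\<^sub>C x"
    and scaleC_scaleC: "a *\<^sub>C b *\<^sub>C x = (a * b) *\<^sub>C x"
    and scaleC_one: "1 *\<^sub>C x = x"
    and scaleR_scaleC: "r *\<^sub>R x = complex_of_real r *\<^sub>C x"

text \<open>The inner product is linear in the first argument and conjugate-linear in the second.
  The underlying real normed space only carries the norm, metric and topology; the norm is the
  one induced by the inner product.\<close>

class complex_inner = complex_vector + real_normed_vector +
  fixes cinner :: "'a \<Rightarrow> 'a \<Rightarrow> complex"
  assumes cinner_commute: "cinner x y = cnj (cinner y x)"
    and cinner_add_left: "cinner (x + y) z = cinner x z + cinner y z"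
    and cinner_scaleC_left: "cinner (a *\<^sub>C x) y = a * cinner x y"
    and cinner_ge_zero: "0 \<le> Re (cinner x x)"
    and cinner_eq_zero_iff: "cinner x x = 0 \<longleftrightarrow> x = 0"
    and norm_eq_sqrt_cinner: "norm x = sqrt (Re (cinner x x))"

class chilbert_space = complex_inner + complete_space

instantiation complex :: chilbert_space
begin

definition scaleC_complex :: "complex \<Rightarrow> complex \<Rightarrow> complex"
  where "scaleC_complex a x = a * x"

definition cinner_complex :: "complex \<Rightarrow> complex \<Rightarrow> complex"
  where "cinner_complex x y = x * cnj y"

instance
  by standard
    (auto simp: scaleC_complex_def cinner_complex_def algebra_simps scaleR_conv_of_real
      cmod_def power2_eq_square)

end

definition bounded_clinear :: "('a::complex_inner \<Rightarrow> 'b::complex_inner) \<Rightarrow> bool"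
  where "bounded_clinear T \<longleftrightarrow> bounded_linear T \<and> (\<forall>c x. T (c *\<^sub>C x) = c *\<^sub>C T x)"

text \<open>For a bounded operator on a Hilbert space, such a function exists by the Riesz
  representation theorem; it is unique because the inner product is nondegenerate.\<close>

definition cadjoint :: "('a::chilbert_space \<Rightarrow> 'a) \<Rightarrow> 'a \<Rightarrow> 'a"  (\<open>_\<^sup>*\<close> [1000] 1000)
  where "T\<^sup>* = (THE S. \<forall>x y. cinner (T x) y = cinner x (S y))"

text \<open>The supremum is taken in the nonnegative reals: inserting \<open>0\<close> only matters on the zero space,
  which has no unit vectors and where the numerical radius is \<open>0\<close>.\<close>

definition numerical_radius :: "('a::complex_inner \<Rightarrow> 'a) \<Rightarrow> real"
  where "numerical_radius T = Sup (insert 0 {cmod (cinner (T x) x) | x. norm x = 1})"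

end

theory Submission
  imports Defs
begin

text \<open>The whole inequality can be checked on one unit vector \<open>x\<close> at a time. Rotating \<open>A\<close> by a
  unimodular \<open>c\<close> that makes \<open>c \<langle>Ax, x\<rangle>\<close> nonnegative, \<open>2 |\<langle>Ax, x\<rangle>|\<close> becomes the inner product of
  \<open>c Ax + cnj c A\<^sup>*x\<close> with \<open>x\<close>, hence is at most the norm of that vector. With
  \<open>P = A\<^sup>*A + AA\<^sup>*\<close>, the square of this norm expands to \<open>\<langle>Px, x\<rangle> + 2 Re (c\<^sup>2 \<langle>A\<^sup>2x, x\<rangle>)\<close>, so
  \<open>4 |\<langle>Ax, x\<rangle>|\<^sup>2 \<le> \<parallel>Px\<parallel> + 2 w(A\<^sup>2)\<close>. Squaring once more gives
  \<open>16 |\<langle>Ax, x\<rangle>|\<^sup>4 \<le> \<parallel>Px\<parallel>\<^sup>2 + 4 w(A\<^sup>2) \<parallel>Px\<parallel> + 4 w(A\<^sup>2)\<^sup>2\<close>. In the linear term \<open>\<parallel>Px\<parallel>\<close> is bounded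
  by the operator norm of \<open>P\<close>; in the quadratic one \<open>\<parallel>Px\<parallel>\<^sup>2 = \<langle>P\<^sup>2x, x\<rangle>\<close>, and the two cross terms
  of \<open>P\<^sup>2\<close> are \<open>A\<^sup>*A\<^sup>2A\<^sup>*\<close> and its adjoint, which contribute \<open>2 Re \<langle>A\<^sup>*A\<^sup>2A\<^sup>*x, x\<rangle>\<close>.

  The adjoint is only a description (\<open>THE\<close>), so these computations need the Riesz representation
  theorem to know that it satisfies \<open>\<langle>Ax, y\<rangle> = \<langle>x, A\<^sup>*y\<rangle>\<close>. The representing vector is found as
  the minimizer of \<open>y \<mapsto> \<parallel>y\<parallel>\<^sup>2/2 - Re (f y)\<close>.\<close>

section \<open>Complex inner products\<close>

lemma cinner_add_right: "cinner x (y + z) = cinner x y + cinner x z"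
  by (metis cinner_add_left cinner_commute complex_cnj_add)

lemma cinner_scaleC_right: "cinner x (a *\<^sub>C y) = cnj a * cinner x y"
  by (metis cinner_commute cinner_scaleC_left complex_cnj_mult)

lemma cinner_scaleR_left: "cinner (r *\<^sub>R x) y = of_real r * cinner x y"
  by (simp add: scaleR_scaleC cinner_scaleC_left)

lemma cinner_scaleR_right: "cinner x (r *\<^sub>R y) = of_real r * cinner x y"
  by (simp add: scaleR_scaleC cinner_scaleC_right)

lemma cinner_minus_left: "cinner (- x) y = - cinner x y"
  using cinner_scaleR_left[of "-1" x y] by simp

lemma cinner_minus_right: "cinner x (- y) = - cinner x y"
  using cinner_scaleR_right[of x "-1" y] by simp

lemma cinner_diff_left: "cinner (x - y) z = cinner x z - cinner y z"
  using cinner_add_left[of x "- y" z] by (simp add: cinner_minus_left)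

lemma cinner_diff_right: "cinner x (y - z) = cinner x y - cinner x z"
  using cinner_add_right[of x y "- z"] by (simp add: cinner_minus_right)

lemmas cinner_algebra =
  cinner_add_left cinner_add_right cinner_diff_left cinner_diff_right
  cinner_scaleC_left cinner_scaleC_right cinner_scaleR_left cinner_scaleR_right

lemma Re_cinner_commute: "Re (cinner x y) = Re (cinner y x)"
  by (subst cinner_commute) simp

lemma power2_norm_eq_Re_cinner: "(norm x)\<^sup>2 = Re (cinner x x)"
  by (simp add: norm_eq_sqrt_cinner cinner_ge_zero)

lemma power2_norm_add: "(norm (x + y))\<^sup>2 = (norm x)\<^sup>2 + (norm y)\<^sup>2 + 2 * Re (cinner x y)"
  using Re_cinner_commute[of x y]
  by (simp add: power2_norm_eq_Re_cinner cinner_algebra)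

lemma power2_norm_diff: "(norm (x - y))\<^sup>2 = (norm x)\<^sup>2 + (norm y)\<^sup>2 - 2 * Re (cinner x y)"
  using Re_cinner_commute[of x y]
  by (simp add: power2_norm_eq_Re_cinner cinner_algebra)

text \<open>The triangle inequality is part of the class of normed spaces, so the real form of the
  Cauchy-Schwarz inequality is read off from it by squaring.\<close>

lemma Re_cinner_le_norm: "Re (cinner x y) \<le> norm x * norm y"
proof -
  have "(norm (x + y))\<^sup>2 \<le> (norm x + norm y)\<^sup>2"
    by (simp add: norm_triangle_ineq power_mono)
  then show ?thesis
    by (simp add: power2_norm_add power2_sum)
qed

lemma unimodular_rotation_to_norm: "\<exists>c. cmod c = 1 \<and> c * z = of_real (cmod z)"
proof (cases "z = 0")
  case True
  then show ?thesis by (intro exI[of _ 1]) simp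
next
  case False
  then show ?thesis
    by (intro exI[of _ "cnj z / of_real (cmod z)"])
      (simp add: norm_divide complex_norm_square[symmetric] mult.commute power2_eq_square)
qed

lemma norm_scaleC: "norm (a *\<^sub>C x) = cmod a * norm x" for x :: "'a::complex_inner"
proof (rule power2_eq_imp_eq)
  have "cinner (a *\<^sub>C x) (a *\<^sub>C x) = of_real ((cmod a)\<^sup>2) * cinner x x"
    by (simp only: cinner_scaleC_left cinner_scaleC_right complex_norm_square mult_ac)
  then show "(norm (a *\<^sub>C x))\<^sup>2 = (cmod a * norm x)\<^sup>2"
    by (simp add: power2_norm_eq_Re_cinner[of x] power2_norm_eq_Re_cinner[of "a *\<^sub>C x"]
        power_mult_distrib)
qed simp_all

lemma cmod_cinner_le_norm: "cmod (cinner x y) \<le> norm x * norm y"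
proof -
  obtain c where c: "cmod c = 1" "c * cinner x y = of_real (cmod (cinner x y))"
    using unimodular_rotation_to_norm by blast
  then have "cmod (cinner x y) = Re (cinner (c *\<^sub>C x) y)"
    by (simp add: cinner_scaleC_left)
  also have "\<dots> \<le> norm (c *\<^sub>C x) * norm y"
    by (rule Re_cinner_le_norm)
  finally show ?thesis
    by (simp add: norm_scaleC c)
qed

lemma cinner_extensionality:
  assumes "\<And>x. cinner x y = cinner x z"
  shows "y = z"
proof -
  have "cinner (y - z) (y - z) = 0"
    using assms by (simp add: cinner_diff_right)
  then show ?thesis
    by (simp add: cinner_eq_zero_iff)
qed

section \<open>The Riesz representation theorem\<close>

text \<open>If \<open>g\<close> is represented by \<open>v\<close> with respect to \<open>Re \<langle>y, v\<rangle>\<close>, then \<open>\<parallel>y\<parallel>\<^sup>2/2 - g y\<close> equals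
  \<open>(\<parallel>y - v\<parallel>\<^sup>2 - \<parallel>v\<parallel>\<^sup>2)/2\<close>; hence \<open>v\<close> can only be the minimizer of this function. The
  parallelogram law makes a minimizing sequence Cauchy; completeness supplies the minimizer.\<close>

lemma riesz_functional_attains_minimum:
  fixes g :: "'a::chilbert_space \<Rightarrow> real"
  assumes "bounded_linear g"
  shows "\<exists>y. \<forall>z. (norm y)\<^sup>2 / 2 - g y \<le> (norm z)\<^sup>2 / 2 - g z"
proof -
  interpret g: bounded_linear g by fact
  define J where "J = (\<lambda>y. (norm y)\<^sup>2 / 2 - g y)"
  define m where "m = Inf (range J)"
  obtain K where K: "\<And>x. \<bar>g x\<bar> \<le> norm x * K"
    using g.bounded by (metis real_norm_def)
  have "- K\<^sup>2 / 2 \<le> J y" for y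
  proof -
    have "0 \<le> (norm y - K)\<^sup>2" by simp
    then show ?thesis
      using K[of y] by (simp add: J_def power2_diff)
  qed
  then have bdd: "bdd_below (range J)"
    by (intro bdd_belowI2)
  then have m_le: "m \<le> J y" for y
    unfolding m_def by (intro cInf_lower) auto
  have "\<exists>y. J y < m + inverse (real (Suc n))" for n
    using cInf_lessD[of "range J" "m + inverse (real (Suc n))"] by (auto simp: m_def)
  then obtain Y where Y: "\<And>n. J (Y n) < m + inverse (real (Suc n))"
    by metis
  have parallelogram: "J y + J z - 2 * J ((1/2) *\<^sub>R (y + z)) = (norm (y - z))\<^sup>2 / 4" for y z
  proof -
    have "(norm ((1/2) *\<^sub>R (y + z)))\<^sup>2 = (norm (y + z))\<^sup>2 / 4"
      unfolding norm_scaleR power_mult_distrib by (simp add: power2_eq_square)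
    then show ?thesis
      unfolding J_def g.scaleR g.add power2_norm_add power2_norm_diff
      by (simp add: field_simps)
  qed
  have dist_le: "(norm (Y i - Y j))\<^sup>2 < 4 * (inverse (real (Suc i)) + inverse (real (Suc j)))" for i j
    using parallelogram[of "Y i" "Y j"] m_le[of "(1/2) *\<^sub>R (Y i + Y j)"] Y[of i] Y[of j] by argo
  have "Cauchy Y"
  proof (rule CauchyI)
    fix e :: real
    assume "0 < e"
    then obtain N where N: "inverse (real (Suc N)) < e\<^sup>2 / 8"
      using reals_Archimedean[of "e\<^sup>2 / 8"] by auto
    have "norm (Y i - Y j) < e" if "N \<le> i" "N \<le> j" for i j
    proof -
      have "inverse (real (Suc i)) \<le> inverse (real (Suc N))"
        "inverse (real (Suc j)) \<le> inverse (real (Suc N))"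
        using that by (auto intro!: le_imp_inverse_le)
      then have "(norm (Y i - Y j))\<^sup>2 < e\<^sup>2"
        using dist_le[of i j] N by argo
      then show ?thesis
        using \<open>0 < e\<close> by (simp add: power_less_imp_less_base)
    qed
    then show "\<exists>N. \<forall>i\<ge>N. \<forall>j\<ge>N. norm (Y i - Y j) < e" by blast
  qed
  then obtain y where "Y \<longlonglongrightarrow> y"
    using Cauchy_convergent_iff convergent_def by blast
  then have "(\<lambda>n. J (Y n)) \<longlonglongrightarrow> J y"
    unfolding J_def by (intro tendsto_intros g.tendsto) auto
  moreover have "(\<lambda>n. m + inverse (real (Suc n))) \<longlonglongrightarrow> m + 0"
    by (intro tendsto_intros LIMSEQ_inverse_real_of_nat)
  ultimately have "J y \<le> m + 0"
    by (rule LIMSEQ_le) (use Y less_imp_le in blast)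
  then have "J y \<le> J z" for z
    using m_le[of z] by simp
  then show ?thesis unfolding J_def by blast
qed

text \<open>At a minimizer the first-order term of \<open>t \<mapsto> \<parallel>y + t h\<parallel>\<^sup>2/2 - Re (f (y + t h))\<close> vanishes, which
  gives the real part of the representation; testing it on \<open>\<i> h\<close> gives the imaginary part.\<close>

theorem riesz_representation:
  fixes f :: "'a::chilbert_space \<Rightarrow> complex"
  assumes "bounded_clinear f"
  shows "\<exists>y. \<forall>x. f x = cinner x y"
proof -
  have f: "bounded_linear f" and f_scaleC: "\<And>c x. f (c *\<^sub>C x) = c * f x"
    using assms by (auto simp: bounded_clinear_def scaleC_complex_def)
  interpret f: bounded_linear f by fact
  have "bounded_linear (\<lambda>x. Re (f x))"
    using bounded_linear_compose[OF bounded_linear_Re f] .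
  then obtain y where y: "\<And>z. (norm y)\<^sup>2 / 2 - Re (f y) \<le> (norm z)\<^sup>2 / 2 - Re (f z)"
    using riesz_functional_attains_minimum by blast
  have Re_eq: "Re (f h) = Re (cinner h y)" for h
  proof -
    define d where "d = Re (cinner h y) - Re (f h)"
    define q where "q = (norm h)\<^sup>2"
    have quad: "0 \<le> t * d + t\<^sup>2 * q / 2" for t
      using y[of "y + t *\<^sub>R h"] Re_cinner_commute[of y h]
      by (simp add: power2_norm_add f.add f.scaleR cinner_algebra power_mult_distrib d_def q_def
          algebra_simps)
    \<comment> \<open>If \<open>d\<close> were nonzero, the step \<open>t = - d/(q + 1)\<close> against the slope would make the quadratic negative.\<close>
    have "q \<ge> 0" by (simp add: q_def)
    have "0 \<le> (- d / (q + 1)) * d + (- d / (q + 1))\<^sup>2 * q / 2"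
      by (rule quad)
    also have "\<dots> = - (d\<^sup>2 * (q + 2) / (2 * (q + 1)\<^sup>2))"
      using \<open>q \<ge> 0\<close> by (simp add: divide_simps power2_eq_square) (simp add: algebra_simps)
    finally have "d\<^sup>2 * (q + 2) / (2 * (q + 1)\<^sup>2) \<le> 0" by simp
    then have "d = 0"
      using \<open>q \<ge> 0\<close> by (auto simp: divide_le_0_iff mult_le_0_iff)
    then show ?thesis by (simp add: d_def)
  qed
  have "f x = cinner x y" for x
    using Re_eq[of x] Re_eq[of "\<i> *\<^sub>C x"]
    by (simp add: complex_eq_iff f_scaleC cinner_scaleC_left)
  then show ?thesis by blast
qed

section \<open>Adjoints and numerical radii of bounded operators\<close>

lemma bounded_clinear_compose:
  "bounded_clinear S \<Longrightarrow> bounded_clinear T \<Longrightarrow> bounded_clinear (S \<circ> T)"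
  unfolding bounded_clinear_def o_def by (auto intro: bounded_linear_compose)

lemma cinner_cadjoint:
  fixes T :: "'a::chilbert_space \<Rightarrow> 'a"
  assumes "bounded_clinear T"
  shows "cinner (T x) y = cinner x (T\<^sup>* y)"
proof -
  interpret T: bounded_linear T
    using assms by (simp add: bounded_clinear_def)
  have "\<exists>z. \<forall>x. cinner (T x) y = cinner x z" for y
  proof (rule riesz_representation)
    have "bounded_linear (\<lambda>x. cinner x y)"
      by (rule bounded_linear_intro[where K = "norm y"])
        (auto simp: cinner_algebra scaleR_conv_of_real cmod_cinner_le_norm)
    then show "bounded_clinear (\<lambda>x. cinner (T x) y)"
      using assms bounded_linear_compose[OF _ T.bounded_linear_axioms]
      by (auto simp: bounded_clinear_def scaleC_complex_def cinner_algebra)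
  qed
  then obtain S where S: "\<forall>x y. cinner (T x) y = cinner x (S y)"
    by metis
  have "\<forall>x y. cinner (T x) y = cinner x (T\<^sup>* y)"
    unfolding cadjoint_def
  proof (rule theI[of _ S], fact S)
    fix R
    assume "\<forall>x y. cinner (T x) y = cinner x (R y)"
    with S show "R = S"
      by (metis cinner_extensionality ext)
  qed
  then show ?thesis by blast
qed

lemma cinner_cadjoint_left:
  fixes T :: "'a::chilbert_space \<Rightarrow> 'a"
  assumes "bounded_clinear T"
  shows "cinner (T\<^sup>* x) y = cinner x (T y)"
  by (metis assms cinner_cadjoint cinner_commute)

lemma bounded_clinear_cadjoint:
  fixes T :: "'a::chilbert_space \<Rightarrow> 'a"
  assumes "bounded_clinear T"
  shows "bounded_clinear (T\<^sup>*)"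
proof -
  interpret T: bounded_linear T
    using assms by (simp add: bounded_clinear_def)
  obtain K where K: "\<And>x. norm (T x) \<le> norm x * K"
    using T.bounded by blast
  note adj = cinner_cadjoint[OF assms, symmetric]
  have scaleC: "T\<^sup>* (c *\<^sub>C x) = c *\<^sub>C T\<^sup>* x" for c x
    by (rule cinner_extensionality) (simp add: adj cinner_scaleC_right)
  have "bounded_linear (T\<^sup>*)"
  proof (rule bounded_linear_intro[where K = K])
    show "T\<^sup>* (x + y) = T\<^sup>* x + T\<^sup>* y" for x y
      by (rule cinner_extensionality) (simp add: adj cinner_add_right)
    show "T\<^sup>* (r *\<^sub>R x) = r *\<^sub>R T\<^sup>* x" for r x
      by (simp add: scaleR_scaleC scaleC)
    show "norm (T\<^sup>* x) \<le> norm x * K" for x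
    proof (cases "T\<^sup>* x = 0")
      case True
      have "0 \<le> norm (T x)" by simp
      also have "\<dots> \<le> norm x * K" by (rule K)
      finally show ?thesis using True by simp
    next
      case False
      have "(norm (T\<^sup>* x))\<^sup>2 = Re (cinner (T (T\<^sup>* x)) x)"
        by (simp add: power2_norm_eq_Re_cinner adj)
      also have "\<dots> \<le> norm (T (T\<^sup>* x)) * norm x"
        by (rule Re_cinner_le_norm)
      also have "\<dots> \<le> norm (T\<^sup>* x) * K * norm x"
        by (rule mult_right_mono[OF K]) simp
      finally show ?thesis
        using False by (simp add: power2_eq_square mult.commute mult.left_commute)
    qed
  qed
  then show ?thesis
    using scaleC by (simp add: bounded_clinear_def)
qed

lemma bdd_above_numerical_range:
  assumes "bounded_clinear T"
  shows "bdd_above (insert 0 {cmod (cinner (T x) x) | x. norm x = 1})"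
proof -
  have T: "bounded_linear T"
    using assms by (simp add: bounded_clinear_def)
  have "cmod (cinner (T x) x) \<le> onorm T" if "norm x = 1" for x
    using cmod_cinner_le_norm[of "T x" x] onorm[OF T, of x] that by simp
  then show ?thesis
    by (auto simp: bdd_above_insert intro: bdd_aboveI[where M = "onorm T"])
qed

lemma cmod_cinner_le_numerical_radius:
  assumes "bounded_clinear T" "norm x = 1"
  shows "cmod (cinner (T x) x) \<le> numerical_radius T"
  unfolding numerical_radius_def
  using assms bdd_above_numerical_range by (intro cSup_upper) auto

lemma numerical_radius_nonneg:
  assumes "bounded_clinear T"
  shows "0 \<le> numerical_radius T"
  unfolding numerical_radius_def
  using bdd_above_numerical_range[OF assms] by (intro cSup_upper) auto

lemma numerical_radius_power_le:
  assumes "bounded_clinear T" "0 < n" "0 \<le> C"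
    and "\<And>x. norm x = 1 \<Longrightarrow> cmod (cinner (T x) x) ^ n \<le> C"
  shows "numerical_radius T ^ n \<le> C"
proof -
  have "cmod (cinner (T x) x) \<le> root n C" if "norm x = 1" for x
    using assms that by (metis norm_ge_zero real_root_le_iff real_root_power_cancel)
  then have "numerical_radius T \<le> root n C"
    unfolding numerical_radius_def using assms by (intro cSup_least) auto
  then have "numerical_radius T ^ n \<le> root n C ^ n"
    using numerical_radius_nonneg[OF assms(1)] by (intro power_mono)
  then show ?thesis
    using assms by simp
qed

section \<open>The two squarings\<close>

text \<open>The identity \<open>4 Re(cA)\<^sup>2 = A\<^sup>*A + AA\<^sup>* + 2 Re(c\<^sup>2A\<^sup>2)\<close>, where \<open>Re(B)\<close> is the self-adjoint part of
  \<open>B\<close>, read at the unit vector \<open>x\<close> for the \<open>c\<close> with \<open>\<langle>Re(cA)x, x\<rangle> = |\<langle>Ax, x\<rangle>|\<close>.\<close>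

lemma power2_cmod_cinner_le:
  fixes A :: "'a::chilbert_space \<Rightarrow> 'a"
  assumes A: "bounded_clinear A" and x: "norm x = 1"
  shows "4 * (cmod (cinner (A x) x))\<^sup>2
    \<le> norm (A\<^sup>* (A x) + A (A\<^sup>* x)) + 2 * cmod (cinner (A (A x)) x)"
proof -
  note adj = cinner_cadjoint[OF A] cinner_cadjoint_left[OF A]
  let ?P = "A\<^sup>* (A x) + A (A\<^sup>* x)"
  obtain c where c: "cmod c = 1" "c * cinner (A x) x = of_real (cmod (cinner (A x) x))"
    using unimodular_rotation_to_norm by blast
  define h where "h = c *\<^sub>C A x + cnj c *\<^sub>C A\<^sup>* x"
  have "cinner (cnj c *\<^sub>C A\<^sup>* x) x = cnj (c * cinner (A x) x)"
    by (simp add: cinner_scaleC_left adj) (metis adj(1) cinner_commute)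
  then have "2 * cmod (cinner (A x) x) = Re (cinner h x)"
    by (simp add: h_def cinner_add_left cinner_scaleC_left c)
  also have "\<dots> \<le> norm h"
    using Re_cinner_le_norm[of h x] x by simp
  finally have "(2 * cmod (cinner (A x) x))\<^sup>2 \<le> (norm h)\<^sup>2"
    by (intro power_mono) auto
  also have "(norm h)\<^sup>2 = (norm (A x))\<^sup>2 + (norm (A\<^sup>* x))\<^sup>2
      + 2 * Re (cinner (c *\<^sub>C A x) (cnj c *\<^sub>C A\<^sup>* x))"
    using c by (simp add: h_def power2_norm_add norm_scaleC)
  also have "(norm (A x))\<^sup>2 + (norm (A\<^sup>* x))\<^sup>2 = Re (cinner ?P x)"
    by (simp add: power2_norm_eq_Re_cinner cinner_add_left adj)
  also have "\<dots> \<le> norm ?P"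
    using Re_cinner_le_norm[of ?P x] x by simp
  also have "Re (cinner (c *\<^sub>C A x) (cnj c *\<^sub>C A\<^sup>* x)) \<le> cmod (cinner (A (A x)) x)"
  proof -
    have "cinner (c *\<^sub>C A x) (cnj c *\<^sub>C A\<^sup>* x) = c * (c * cinner (A (A x)) x)"
      by (simp add: cinner_scaleC_left cinner_scaleC_right adj(1) mult.left_commute)
    then show ?thesis
      using complex_Re_le_cmod[of "c * (c * cinner (A (A x)) x)"] c by (simp add: norm_mult)
  qed
  finally show ?thesis
    by (simp add: power_mult_distrib)
qed

text \<open>Here \<open>\<parallel>Px\<parallel>\<^sup>2 = \<parallel>A\<^sup>*Ax\<parallel>\<^sup>2 + \<parallel>AA\<^sup>*x\<parallel>\<^sup>2 + 2 Re \<langle>AA\<^sup>*x, A\<^sup>*Ax\<rangle>\<close>, and both summands of \<open>P\<close> are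
  self-adjoint, so each inner product can be moved onto \<open>x\<close>.\<close>

lemma power2_norm_cadjoint_sum_le:
  fixes A :: "'a::chilbert_space \<Rightarrow> 'a"
  assumes A: "bounded_clinear A" and x: "norm x = 1"
  shows "(norm (A\<^sup>* (A x) + A (A\<^sup>* x)))\<^sup>2
    \<le> norm (A\<^sup>* (A (A\<^sup>* (A x))) + A (A\<^sup>* (A (A\<^sup>* x)))) + 2 * cmod (cinner (A\<^sup>* (A (A (A\<^sup>* x)))) x)"
proof -
  note adj = cinner_cadjoint[OF A] cinner_cadjoint_left[OF A]
  let ?Q = "A\<^sup>* (A (A\<^sup>* (A x))) + A (A\<^sup>* (A (A\<^sup>* x)))"
  have "(norm (A\<^sup>* (A x)))\<^sup>2 + (norm (A (A\<^sup>* x)))\<^sup>2 = Re (cinner ?Q x)"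
    by (simp add: power2_norm_eq_Re_cinner cinner_add_left adj)
  moreover have "Re (cinner (A\<^sup>* (A x)) (A (A\<^sup>* x))) = Re (cinner (A\<^sup>* (A (A (A\<^sup>* x)))) x)"
    by (subst Re_cinner_commute) (simp add: adj)
  ultimately have "(norm (A\<^sup>* (A x) + A (A\<^sup>* x)))\<^sup>2
      = Re (cinner ?Q x) + 2 * Re (cinner (A\<^sup>* (A (A (A\<^sup>* x)))) x)"
    by (simp add: power2_norm_add)
  then show ?thesis
    using Re_cinner_le_norm[of ?Q x] x complex_Re_le_cmod[of "cinner (A\<^sup>* (A (A (A\<^sup>* x)))) x"]
    by simp
qed

theorem theorem2p18:
  fixes A :: "'a::chilbert_space \<Rightarrow> 'a"
  assumes "bounded_clinear A"
  shows "numerical_radius A ^ 4 \<le>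
    1/4 * ((numerical_radius (A ^^ 2))\<^sup>2
      + 1/4 * onorm (\<lambda>x. ((A\<^sup>* \<circ> A) ^^ 2) x + ((A \<circ> A\<^sup>*) ^^ 2) x)
      + 1/2 * numerical_radius (A\<^sup>* \<circ> A ^^ 2 \<circ> A\<^sup>*)
      + numerical_radius (A ^^ 2) * onorm (\<lambda>x. (A\<^sup>* \<circ> A) x + (A \<circ> A\<^sup>*) x))"
proof -
  let ?P = "\<lambda>x. (A\<^sup>* \<circ> A) x + (A \<circ> A\<^sup>*) x"
  let ?Q = "\<lambda>x. ((A\<^sup>* \<circ> A) ^^ 2) x + ((A \<circ> A\<^sup>*) ^^ 2) x"
  let ?R = "A\<^sup>* \<circ> A ^^ 2 \<circ> A\<^sup>*"
  let ?w = "numerical_radius (A ^^ 2)"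
  have sq: "T ^^ 2 = T \<circ> T" for T :: "'a \<Rightarrow> 'a"
    by (simp add: numeral_2_eq_2)
  note A = assms
  note A' = bounded_clinear_cadjoint[OF A]
  note comp = bounded_clinear_compose
  have A2: "bounded_clinear (A ^^ 2)" and R: "bounded_clinear ?R"
    by (auto simp only: sq intro!: comp A A')
  have "bounded_clinear (A\<^sup>* \<circ> A)" "bounded_clinear (A \<circ> A\<^sup>*)"
    "bounded_clinear ((A\<^sup>* \<circ> A) ^^ 2)" "bounded_clinear ((A \<circ> A\<^sup>*) ^^ 2)"
    by (auto simp only: sq intro!: comp A A')
  then have P: "bounded_linear ?P" and Q: "bounded_linear ?Q"
    unfolding bounded_clinear_def by (blast intro: bounded_linear_add)+
  have w: "0 \<le> ?w" and wR: "0 \<le> numerical_radius ?R"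
    using numerical_radius_nonneg A2 R by blast+
  show ?thesis
  proof (rule numerical_radius_power_le[OF A])
    show "0 \<le> 1/4 * (?w\<^sup>2 + 1/4 * onorm ?Q + 1/2 * numerical_radius ?R + ?w * onorm ?P)"
      using w wR onorm_pos_le[OF P] onorm_pos_le[OF Q] by simp
    fix x :: 'a
    assume x: "norm x = 1"
    have Px: "norm (?P x) \<le> onorm ?P" and Qx: "norm (?Q x) \<le> onorm ?Q"
      using onorm[OF P, of x] onorm[OF Q, of x] x by simp_all
    have "4 * (cmod (cinner (A x) x))\<^sup>2 \<le> norm (?P x) + 2 * ?w"
      using power2_cmod_cinner_le[OF A x] cmod_cinner_le_numerical_radius[OF A2 x]
      by (simp add: sq)
    then have "(4 * (cmod (cinner (A x) x))\<^sup>2)\<^sup>2 \<le> (norm (?P x) + 2 * ?w)\<^sup>2"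
      by (intro power_mono) auto
    then have "16 * cmod (cinner (A x) x) ^ 4 \<le> (norm (?P x))\<^sup>2 + 4 * (?w * norm (?P x)) + 4 * ?w\<^sup>2"
      by (simp add: power2_sum power_mult_distrib mult_ac flip: power_mult)
    moreover have "(norm (?P x))\<^sup>2 \<le> onorm ?Q + 2 * numerical_radius ?R"
      using power2_norm_cadjoint_sum_le[OF A x] cmod_cinner_le_numerical_radius[OF R x] Qx
      by (simp add: sq)
    moreover have "?w * norm (?P x) \<le> ?w * onorm ?P"
      using Px w by (rule mult_left_mono)
    ultimately show "cmod (cinner (A x) x) ^ 4
        \<le> 1/4 * (?w\<^sup>2 + 1/4 * onorm ?Q + 1/2 * numerical_radius ?R + ?w * onorm ?P)"
      by argo
  qed simp
qed

end
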